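(* Let $(X,T)$ be a topological dynamical system. Then $(X,T)$ has the vague specification property if and only if $(X,T)$ has the asymptotic average shadowing property.
   Context: $\mathbb{N}_0=\{0,1,2,\ldots\}$. A topological dynamical system $(X,T)$ consists of a compact metrizable space $X$ and a continuous map $T\colon X\to X$. Fix a compatible metric $\rho$ on $X$ of diameter at most $1$ (the notions below do not depend on this choice). For $A\subseteq\mathbb{N}_0$ we write $d(A)=1$ if $\lim_{n\to\infty}\frac{|A\cap[0,n)|}{n}=1$ (asymptotic density). $X^\infty$ is the set of all sequences $\underline{x}=\{x_n\}_{n=0}^\infty$ in $X$, with the product topology; $S\colon X^\infty\to X^\infty$ is the shift $S(\underline{x})=\{x_{n+1}\}_{n=0}^\infty$. For $z\in X$ put $\underline{z}_T=\{T^n(z)\}_{n=0}^\infty\in X^\infty$, and $\Gamma_T=\{\underline{z}_T : z\in X\}$. For $\underline{x},\underline{z}\in X^\infty$ let $\rho_B(\underline{x},\underline{z})=\limsup_{n\to\infty}\frac1n\sum_{i=0}^{n-1}\rho(x_i,z_i)$. Vague pseudo-orbit: $\underline{x}\in X^\infty$ such that for every open set $\mathcal{U}\subseteq X^\infty$ containing $\Gamma_T$ one has $d(\{n\in\mathbb{N}_0 : S^n(\underline{x})\in\mathcal{U}\})=1$. Vague specification property: for every vague pseudo-orbit $\underline{x}$ in $(X,T)$ there is $z\in X$ such that for every $\varepsilon>0$, $d(\{n\in\mathbb{N}_0 : \rho(T^n(z),x_n)<\varepsilon\})=1$. Asymptotic average pseudo-orbit: $\underline{x}\in X^\infty$ with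 $\limsup_{n\to\infty}\frac1n\sum_{i=0}^{n-1}\rho(T(x_i),x_{i+1})=0$. Asymptotic average shadowing property: for every asymptotic average pseudo-orbit $\underline{x}$ in $(X,T)$ there is $z\in X$ with $\rho_B(\underline{z}_T,\underline{x})=0$. *)

theory Defs
  imports "HOL-Analysis.Analysis"
begin

definition tds :: "'a topology \<Rightarrow> ('a \<Rightarrow> 'a) \<Rightarrow> bool" where
  "tds X T \<longleftrightarrow> compact_space X \<and> metrizable_space X \<and> continuous_map X X T"

definition compatible_metric :: "'a topology \<Rightarrow> ('a \<Rightarrow> 'a \<Rightarrow> real) \<Rightarrow> bool" where
  "compatible_metric X \<rho> \<longleftrightarrow>
     Metric_space (topspace X) \<rho> \<and> Metric_space.mtopology (topspace X) \<rho> = X"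

definition density_one :: "nat set \<Rightarrow> bool" where
  "density_one A \<longleftrightarrow> (\<lambda>n. real (card (A \<inter> {0..<n})) / real n) \<longlonglongrightarrow> 1"

definition seq_space :: "'a topology \<Rightarrow> (nat \<Rightarrow> 'a) topology" where
  "seq_space X = product_topology (\<lambda>_. X) UNIV"

definition seq_shift :: "(nat \<Rightarrow> 'a) \<Rightarrow> nat \<Rightarrow> 'a" where
  "seq_shift x = (\<lambda>n. x (n + 1))"

definition orbit_seq :: "('a \<Rightarrow> 'a) \<Rightarrow> 'a \<Rightarrow> nat \<Rightarrow> 'a" where
  "orbit_seq T z = (\<lambda>n. (T ^^ n) z)"

definition orbit_space :: "'a topology \<Rightarrow> ('a \<Rightarrow> 'a) \<Rightarrow> (nat \<Rightarrow> 'a) set" where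
  "orbit_space X T = orbit_seq T ` topspace X"

(* The limit superior is taken in ereal because type real is not a complete lattice;
   the term at n = 0 is 0 / 0 = 0 and does not affect it. *)
definition limsup_average :: "(nat \<Rightarrow> real) \<Rightarrow> ereal" where
  "limsup_average a = limsup (\<lambda>n. ereal ((\<Sum>i<n. a i) / real n))"

definition besicovitch_dist :: "('a \<Rightarrow> 'a \<Rightarrow> real) \<Rightarrow> (nat \<Rightarrow> 'a) \<Rightarrow> (nat \<Rightarrow> 'a) \<Rightarrow> ereal" where
  "besicovitch_dist \<rho> x z = limsup_average (\<lambda>i. \<rho> (x i) (z i))"

definition vague_pseudo_orbit :: "'a topology \<Rightarrow> ('a \<Rightarrow> 'a) \<Rightarrow> (nat \<Rightarrow> 'a) \<Rightarrow> bool" where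
  "vague_pseudo_orbit X T x \<longleftrightarrow>
     x \<in> topspace (seq_space X) \<and>
     (\<forall>U. openin (seq_space X) U \<and> orbit_space X T \<subseteq> U \<longrightarrow>
        density_one {n. (seq_shift ^^ n) x \<in> U})"

definition vague_specification ::
    "'a topology \<Rightarrow> ('a \<Rightarrow> 'a \<Rightarrow> real) \<Rightarrow> ('a \<Rightarrow> 'a) \<Rightarrow> bool" where
  "vague_specification X \<rho> T \<longleftrightarrow>
     (\<forall>x. vague_pseudo_orbit X T x \<longrightarrow>
        (\<exists>z\<in>topspace X. \<forall>\<epsilon>>0. density_one {n. \<rho> ((T ^^ n) z) (x n) < \<epsilon>}))"

definition asymptotic_average_pseudo_orbit ::
    "'a topology \<Rightarrow> ('a \<Rightarrow> 'a \<Rightarrow> real) \<Rightarrow> ('a \<Rightarrow> 'a) \<Rightarrow> (nat \<Rightarrow> 'a) \<Rightarrow> bool" where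
  "asymptotic_average_pseudo_orbit X \<rho> T x \<longleftrightarrow>
     x \<in> topspace (seq_space X) \<and> limsup_average (\<lambda>i. \<rho> (T (x i)) (x (i + 1))) = 0"

definition asymptotic_average_shadowing ::
    "'a topology \<Rightarrow> ('a \<Rightarrow> 'a \<Rightarrow> real) \<Rightarrow> ('a \<Rightarrow> 'a) \<Rightarrow> bool" where
  "asymptotic_average_shadowing X \<rho> T \<longleftrightarrow>
     (\<forall>x. asymptotic_average_pseudo_orbit X \<rho> T x \<longrightarrow>
        (\<exists>z\<in>topspace X. besicovitch_dist \<rho> (orbit_seq T z) x = 0))"

end

theory Submission imports Defs begin

text \<open>
  Both kinds of pseudo-orbit coincide, and so do both kinds of tracing. For a sequence with values in
  \<open>[0, 1]\<close>, vanishing Cesaro mean means that it is below every \<open>\<epsilon> > 0\<close> on a set of density one; this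
  settles the tracing conditions and shows that a vague pseudo-orbit, tested on the open sets
  \<open>\<rho> (T (y 0)) (y 1) < \<epsilon>\<close>, is an asymptotic average pseudo-orbit. Conversely, if \<open>U\<close> is an open
  neighbourhood of the set of orbits, then \<open>U\<close> and the open sets \<open>\<rho> (T (y i)) (y (i + 1)) > \<epsilon>\<close> cover
  the compact sequence space, so finitely many of them do, and membership in \<open>U\<close> is
  forced by finitely many conditions, each of which holds with density one along the pseudo-orbit.
\<close>

text \<open>A real limit replaces the \<open>ereal\<close> limsup of \<open>limsup_average\<close>:
  for nonnegative sequences both conditions agree, and limits support comparison, sums and
  scaling.\<close>

definition null_mean :: "(nat \<Rightarrow> real) \<Rightarrow> bool" where
  "null_mean a \<longleftrightarrow> (\<lambda>n. (\<Sum>i<n. a i) / real n) \<longlonglongrightarrow> 0"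

lemma null_mean_mono:
  assumes "null_mean b" "\<And>i. 0 \<le> a i" "\<And>i. a i \<le> b i"
  shows "null_mean a"
  unfolding null_mean_def
proof (rule tendsto_sandwich[OF _ _ tendsto_const assms(1)[unfolded null_mean_def]])
  show "\<forall>\<^sub>F n in sequentially. 0 \<le> (\<Sum>i<n. a i) / real n"
    using assms(2) by (intro always_eventually allI divide_nonneg_nonneg sum_nonneg) auto
  show "\<forall>\<^sub>F n in sequentially. (\<Sum>i<n. a i) / real n \<le> (\<Sum>i<n. b i) / real n"
    using assms(3) by (intro always_eventually allI divide_right_mono sum_mono) auto
qed

lemma null_mean_add: "null_mean a \<Longrightarrow> null_mean b \<Longrightarrow> null_mean (\<lambda>i. a i + b i)"
  unfolding null_mean_def by (drule (1) tendsto_add) (simp add: sum.distrib add_divide_distrib)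

lemma null_mean_cmult: "null_mean a \<Longrightarrow> null_mean (\<lambda>i. c * a i)"
  unfolding null_mean_def
  by (drule tendsto_mult_left[where c = c]) (simp add: sum_distrib_left[symmetric])

text \<open>Restoring the nonnegative term \<open>a 0\<close> can only increase the sum, and
  changing the divisor from \<open>n\<close> to \<open>Suc n\<close> costs a factor of at most 2.
  This is the source of shift invariance of density one.\<close>

lemma null_mean_Suc:
  assumes "null_mean a" "\<And>i. 0 \<le> a i"
  shows "null_mean (\<lambda>i. a (Suc i))"
  unfolding null_mean_def
proof (rule tendsto_sandwich[OF _ _ tendsto_const])
  show "\<forall>\<^sub>F n in sequentially. 0 \<le> (\<Sum>i<n. a (Suc i)) / real n"
    using assms(2) by (intro always_eventually allI divide_nonneg_nonneg sum_nonneg) auto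
  show "\<forall>\<^sub>F n in sequentially. (\<Sum>i<n. a (Suc i)) / real n \<le> 2 * ((\<Sum>i<Suc n. a i) / real (Suc n))"
  proof (rule eventually_mono[OF eventually_gt_at_top[of 0]])
    fix n :: nat
    assume "0 < n"
    have "(\<Sum>i<n. a (Suc i)) \<le> (\<Sum>i<Suc n. a i)"
      using assms(2)[of 0] by (simp add: sum.lessThan_Suc_shift del: sum.lessThan_Suc)
    moreover have "0 \<le> (\<Sum>i<Suc n. a i)"
      using assms(2) by (rule sum_nonneg)
    ultimately have "(\<Sum>i<n. a (Suc i)) * real (Suc n) \<le> (\<Sum>i<Suc n. a i) * (2 * real n)"
      using \<open>0 < n\<close> by (intro mult_mono) auto
    then show "(\<Sum>i<n. a (Suc i)) / real n \<le> 2 * ((\<Sum>i<Suc n. a i) / real (Suc n))"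
      using \<open>0 < n\<close> by (simp add: field_simps del: sum.lessThan_Suc)
  qed
  show "(\<lambda>n. 2 * ((\<Sum>i<Suc n. a i) / real (Suc n))) \<longlonglongrightarrow> 0"
    using tendsto_mult_left[OF LIMSEQ_Suc[OF assms(1)[unfolded null_mean_def]], of 2]
    by (simp del: sum.lessThan_Suc of_nat_Suc)
qed

text \<open>Nonnegative averages have liminf at least 0, so a limsup of 0 forces liminf and limsup
  to coincide.\<close>

lemma limsup_average_eq_0_iff:
  assumes "\<And>i. 0 \<le> a i"
  shows "limsup_average a = 0 \<longleftrightarrow> null_mean a"
proof
  assume "null_mean a"
  then have "(\<lambda>n. ereal ((\<Sum>i<n. a i) / real n)) \<longlonglongrightarrow> 0"
    by (simp add: null_mean_def zero_ereal_def)
  then show "limsup_average a = 0"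
    unfolding limsup_average_def by (intro lim_imp_Limsup) auto
next
  have "0 \<le> (\<Sum>i<n. a i) / real n" for n
    using assms by (intro divide_nonneg_nonneg sum_nonneg) auto
  then have "0 \<le> liminf (\<lambda>n. ereal ((\<Sum>i<n. a i) / real n))"
    by (intro Liminf_bounded always_eventually allI) (simp only: ereal_less_eq)
  moreover assume limsup: "limsup_average a = 0"
  ultimately have "liminf (\<lambda>n. ereal ((\<Sum>i<n. a i) / real n)) = 0"
    using Liminf_le_Limsup[of sequentially "\<lambda>n. ereal ((\<Sum>i<n. a i) / real n)"]
    by (simp add: limsup_average_def)
  with limsup have "(\<lambda>n. ereal ((\<Sum>i<n. a i) / real n)) \<longlonglongrightarrow> 0"
    by (simp add: tendsto_iff_Liminf_eq_Limsup limsup_average_def)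
  then show "null_mean a"
    by (simp add: null_mean_def zero_ereal_def)
qed

text \<open>The frequencies of a set and of its complement add up to 1, so closure properties of
  density one sets become estimates between indicators of complements.\<close>

lemma density_one_iff_null_mean: "density_one A \<longleftrightarrow> null_mean (indicator (- A))"
proof -
  \<comment> \<open>At \<open>n = 0\<close> division by zero makes the left side 0 and the right
    side 1, so the identity is only used eventually.\<close>
  have "real (card (A \<inter> {0..<n})) / real n = 1 - (\<Sum>i<n. indicator (- A) i) / real n"
    if "0 < n" for n
  proof -
    have "(\<Sum>i<n. indicator (- A) i :: real) = (\<Sum>i<n. 1 - indicator A i)"
      by (intro sum.cong) (auto simp: indicator_def)
    also have "\<dots> = real n - real (card (A \<inter> {0..<n}))"
      by (simp add: sum_subtractf sum.If_cases indicator_def atLeast0LessThan Int_commute)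
    finally show ?thesis
      using that by (simp add: field_simps)
  qed
  then have "density_one A \<longleftrightarrow> (\<lambda>n. 1 - (\<Sum>i<n. indicator (- A) i) / real n) \<longlonglongrightarrow> (1::real)"
    unfolding density_one_def
    by (intro filterlim_cong refl eventually_mono[OF eventually_gt_at_top[of 0]])
  also have "\<dots> \<longleftrightarrow> null_mean (indicator (- A))"
    unfolding null_mean_def
    by (auto dest: tendsto_diff[OF tendsto_const[of "1::real"]])
  finally show ?thesis .
qed

lemma density_one_mono: "density_one A \<Longrightarrow> A \<subseteq> B \<Longrightarrow> density_one B"
  unfolding density_one_iff_null_mean by (erule null_mean_mono) (auto simp: indicator_def)

text \<open>The complement of an intersection is a union, whose indicator is at most the sum of the
  two indicators.\<close>

lemma density_one_Int:
  assumes "density_one A" "density_one B"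
  shows "density_one (A \<inter> B)"
  unfolding density_one_iff_null_mean
  by (rule null_mean_mono[OF null_mean_add[OF assms[unfolded density_one_iff_null_mean]]])
    (auto simp: indicator_def)

lemma density_one_UNIV: "density_one UNIV"
  by (simp add: density_one_iff_null_mean null_mean_def)

lemma density_one_INT:
  "finite I \<Longrightarrow> (\<And>i. i \<in> I \<Longrightarrow> density_one (A i)) \<Longrightarrow> density_one (\<Inter>i\<in>I. A i)"
  by (induction rule: finite_induct) (auto simp: density_one_UNIV density_one_Int)

text \<open>Needed because a condition on coordinate \<open>k\<close> of the \<open>n\<close>-fold
  shift speaks about time \<open>n + k\<close>.\<close>

lemma density_one_shift: "density_one A \<Longrightarrow> density_one {n. n + k \<in> A}"
proof (induction k)
  case (Suc k)
  then have "null_mean (\<lambda>i. indicator (- {n. n + k \<in> A}) (Suc i))"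
    by (intro null_mean_Suc) (auto simp: density_one_iff_null_mean)
  then show ?case
    unfolding density_one_iff_null_mean by (rule null_mean_mono) (auto simp: indicator_def)
qed simp

text \<open>Forwards this is Markov's inequality: the indicator of
  \<open>a n \<ge> \<epsilon>\<close> is at most \<open>a n / \<epsilon>\<close>. Backwards, terms
  are small off a set of density zero and bounded by 1 on it.\<close>

lemma null_mean_iff_density_one:
  assumes "\<And>i. 0 \<le> a i" "\<And>i. a i \<le> 1"
  shows "null_mean a \<longleftrightarrow> (\<forall>\<epsilon>>0. density_one {n. a n < \<epsilon>})"
proof (intro iffI allI impI)
  fix \<epsilon> :: real
  assume "null_mean a" "0 < \<epsilon>"
  from \<open>null_mean a\<close> have "null_mean (\<lambda>i. 1 / \<epsilon> * a i)"
    by (rule null_mean_cmult)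
  then show "density_one {n. a n < \<epsilon>}"
    unfolding density_one_iff_null_mean
    by (rule null_mean_mono) (use assms(1) \<open>0 < \<epsilon>\<close> in \<open>simp_all add: indicator_def field_simps\<close>)
next
  assume *: "\<forall>\<epsilon>>0. density_one {n. a n < \<epsilon>}"
  show "null_mean a"
    unfolding null_mean_def
  proof (rule LIMSEQ_I)
    fix r :: real
    assume "0 < r"
    define b :: "nat \<Rightarrow> real" where "b = indicator (- {n. a n < r / 2})"
    have "(\<lambda>n. (\<Sum>i<n. b i) / real n) \<longlonglongrightarrow> 0"
      using *[rule_format, of "r / 2"] \<open>0 < r\<close>
      unfolding b_def density_one_iff_null_mean null_mean_def by (simp only: half_gt_zero)
    then obtain N where N: "\<And>n. n \<ge> N \<Longrightarrow> \<bar>(\<Sum>i<n. b i) / real n\<bar> < r / 2"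
      using \<open>0 < r\<close> LIMSEQ_D[of "\<lambda>n. (\<Sum>i<n. b i) / real n" 0 "r / 2"] by auto
    \<comment> \<open>The maximum with 1 keeps the divisor positive.\<close>
    have "\<bar>(\<Sum>i<n. a i) / real n\<bar> < r" if n: "n \<ge> max N 1" for n
    proof -
      \<comment> \<open>Small terms are absorbed by \<open>r / 2\<close>; at the exceptional indices
        \<open>b i = 1\<close> and the bound \<open>a i \<le> 1\<close> applies. The mean of
        \<open>b\<close> uses up the other half of \<open>r\<close>.\<close>
      have "a i \<le> r / 2 + b i" for i
        using assms(2)[of i] \<open>0 < r\<close> by (cases "a i < r / 2") (simp_all add: b_def)
      then have "(\<Sum>i<n. a i) \<le> (\<Sum>i<n. r / 2 + b i)"
        by (intro sum_mono)
      also have "\<dots> = real n * (r / 2) + (\<Sum>i<n. b i)"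
        by (simp add: sum.distrib)
      finally have "(\<Sum>i<n. a i) / real n \<le> r / 2 + (\<Sum>i<n. b i) / real n"
        using n by (simp add: field_simps)
      moreover have "0 \<le> (\<Sum>i<n. a i) / real n"
        using assms(1) by (intro divide_nonneg_nonneg sum_nonneg) auto
      ultimately show ?thesis
        using N[of n] n by linarith
    qed
    then show "\<exists>N. \<forall>n\<ge>N. norm ((\<Sum>i<n. a i) / real n - 0) < r"
      by (intro exI[of _ "max N 1"]) simp
  qed
qed

lemma limsup_average_eq_0_iff_density_one:
  assumes "\<And>i. 0 \<le> a i" "\<And>i. a i \<le> 1"
  shows "limsup_average a = 0 \<longleftrightarrow> (\<forall>\<epsilon>>0. density_one {n. a n < \<epsilon>})"
  using assms by (simp add: limsup_average_eq_0_iff null_mean_iff_density_one)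

lemma seq_shift_funpow: "(seq_shift ^^ n) x = (\<lambda>k. x (n + k))"
  by (induction n) (auto simp: seq_shift_def)

lemma topspace_seq_space: "x \<in> topspace (seq_space X) \<longleftrightarrow> (\<forall>n. x n \<in> topspace X)"
  by (auto simp: seq_space_def PiE_UNIV_domain)

text \<open>The metric is composed with two continuous maps into \<open>X\<close>. Strict
  inequalities on a step error thereby define open sets of sequences.\<close>

lemma continuous_map_step_error:
  assumes "continuous_map X X T" "compatible_metric X \<rho>"
  shows "continuous_map (seq_space X) euclideanreal (\<lambda>y. \<rho> (T (y i)) (y (Suc i)))"
proof -
  interpret M: Metric_space "topspace X" \<rho>
    using assms(2) by (simp add: compatible_metric_def)
  have X: "M.mtopology = X"
    using assms(2) by (simp add: compatible_metric_def)
  have proj: "continuous_map (seq_space X) X (\<lambda>y. y j)" for j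
    unfolding seq_space_def by (intro continuous_map_product_projection) simp
  have "continuous_map (seq_space X) X (\<lambda>y. T (y i))"
    using continuous_map_compose[OF proj assms(1)] by (simp add: o_def)
  with proj show ?thesis
    using continuous_map_mdist[of "seq_space X" M.Self "\<lambda>y. T (y i)" "\<lambda>y. y (Suc i)"]
    by (simp add: mtopology_of_def X)
qed

text \<open>Two facts link the notions: orbits are exactly the sequences in \<open>X\<close> whose
  step errors all vanish, and step error \<open>i\<close> of the \<open>n\<close>-fold shift of
  \<open>x\<close> is step error \<open>n + i\<close> of \<open>x\<close>.\<close>

lemma vague_pseudo_orbit_iff:
  assumes "tds X T" "compatible_metric X \<rho>"
    and "\<And>x y. x \<in> topspace X \<Longrightarrow> y \<in> topspace X \<Longrightarrow> \<rho> x y \<le> 1"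
  shows "vague_pseudo_orbit X T x \<longleftrightarrow> asymptotic_average_pseudo_orbit X \<rho> T x"
proof (cases "x \<in> topspace (seq_space X)")
  case x: True
  interpret M: Metric_space "topspace X" \<rho>
    using assms(2) by (simp add: compatible_metric_def)
  have T: "continuous_map X X T"
    using assms(1) by (simp add: tds_def)
  then have T_in: "T u \<in> topspace X" if "u \<in> topspace X" for u
    using that by (auto simp: continuous_map_def)
  let ?e = "\<lambda>i y. \<rho> (T (y i)) (y (Suc i))"
  have open_less: "openin (seq_space X) {y \<in> topspace (seq_space X). ?e i y \<in> {..<\<epsilon>}}" for i \<epsilon>
    by (rule openin_continuous_map_preimage[OF continuous_map_step_error[OF T assms(2)]]) simp
  have open_greater: "openin (seq_space X) {y \<in> topspace (seq_space X). ?e i y \<in> {\<epsilon><..}}" for i \<epsilon>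
    by (rule openin_continuous_map_preimage[OF continuous_map_step_error[OF T assms(2)]]) simp
  have aapo: "asymptotic_average_pseudo_orbit X \<rho> T x \<longleftrightarrow> (\<forall>\<epsilon>>0. density_one {n. ?e n x < \<epsilon>})"
    using x limsup_average_eq_0_iff_density_one[of "\<lambda>n. ?e n x"]
    by (simp add: asymptotic_average_pseudo_orbit_def topspace_seq_space assms(3) T_in)
  have shift_in: "(seq_shift ^^ n) x \<in> topspace (seq_space X)" for n
    using x by (simp add: seq_shift_funpow topspace_seq_space)
  show ?thesis
    unfolding aapo
  proof (intro iffI allI impI)
    fix \<epsilon> :: real
    assume vague: "vague_pseudo_orbit X T x" and "0 < \<epsilon>"
    \<comment> \<open>Testing the first step error suffices: the \<open>n\<close>-fold shift of
      \<open>x\<close> lies in \<open>?U\<close> iff \<open>?e n x < \<epsilon>\<close>.\<close>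
    let ?U = "{y \<in> topspace (seq_space X). ?e 0 y \<in> {..<\<epsilon>}}"
    have orbit_in: "(T ^^ n) z \<in> topspace X" if "z \<in> topspace X" for n z
      using that by (induction n) (auto simp: T_in)
    then have "orbit_space X T \<subseteq> ?U"
      using \<open>0 < \<epsilon>\<close> by (auto simp: orbit_space_def orbit_seq_def topspace_seq_space T_in)
    then have "density_one {n. (seq_shift ^^ n) x \<in> ?U}"
      using vague open_less unfolding vague_pseudo_orbit_def by blast
    then show "density_one {n. ?e n x < \<epsilon>}"
      by (rule density_one_mono) (auto simp: seq_shift_funpow)
  next
    assume small: "\<forall>\<epsilon>>0. density_one {n. ?e n x < \<epsilon>}"
    show "vague_pseudo_orbit X T x"
      unfolding vague_pseudo_orbit_def
    proof (intro conjI allI impI x)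
      fix U
      assume U: "openin (seq_space X) U \<and> orbit_space X T \<subseteq> U"
      \<comment> \<open>\<open>V (i, \<epsilon>)\<close> collects the sequences that violate the
        orbit condition at step \<open>i\<close> by more than \<open>\<epsilon>\<close>; the strict
        inequality makes it open.\<close>
      define V where "V = (\<lambda>(i, \<epsilon>). {y \<in> topspace (seq_space X). ?e i y \<in> {\<epsilon><..}})"
      let ?I = "UNIV \<times> {0<..} :: (nat \<times> real) set"
      have cover: "topspace (seq_space X) \<subseteq> \<Union>(insert U (V ` ?I))"
      proof
        fix y
        assume y: "y \<in> topspace (seq_space X)"
        show "y \<in> \<Union>(insert U (V ` ?I))"
        proof (cases "\<forall>i. ?e i y = 0")
          case True
          then have step: "y (Suc i) = T (y i)" for i
            using y M.zero[of "T (y i)" "y (Suc i)"] by (auto simp: topspace_seq_space T_in)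
          have "y i = (T ^^ i) (y 0)" for i
            by (induction i) (auto simp: step)
          then have "y = orbit_seq T (y 0)"
            unfolding orbit_seq_def by (rule ext)
          then have "y \<in> orbit_space X T"
            using y unfolding orbit_space_def topspace_seq_space by blast
          then show ?thesis
            using U by auto
        next
          case False
          then obtain i where "?e i y \<noteq> 0"
            by auto
          then have "0 < ?e i y"
            using M.nonneg[of "T (y i)" "y (Suc i)"] by linarith
          \<comment> \<open>Half of the positive error is a positive threshold strictly below that
            error.\<close>
          then have "y \<in> V (i, ?e i y / 2)" "(i, ?e i y / 2) \<in> ?I"
            using y by (auto simp: V_def)
          then show ?thesis
            by blast
        qed
      qed
      have "compact_space (seq_space X)"
        using assms(1) by (simp add: seq_space_def compact_space_product_topology tds_def)
      moreover have "openin (seq_space X) W" if "W \<in> insert U (V ` ?I)" for W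
        using that U open_greater by (auto simp: V_def)
      ultimately obtain \<F> where \<F>: "finite \<F>" "\<F> \<subseteq> insert U (V ` ?I)"
          "topspace (seq_space X) \<subseteq> \<Union>\<F>"
        using cover unfolding compact_space_alt by meson
      \<comment> \<open>Apart from \<open>U\<close>, the finite subcover consists of sets
        \<open>V p\<close>, so finitely many pairs \<open>p\<close> suffice to index them.\<close>
      have "finite (\<F> - {U})" "\<F> - {U} \<subseteq> V ` ?I"
        using \<F> by auto
      then obtain J where J: "J \<subseteq> ?I" "finite J" "\<F> - {U} = V ` J"
        by (meson finite_subset_image)
      have "density_one {n. ?e (n + i) x < \<epsilon>}" if "(i, \<epsilon>) \<in> J" for i \<epsilon>
        using density_one_shift[of "{n. ?e n x < \<epsilon>}" i] small that J(1) by auto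
      then have "density_one (\<Inter>p\<in>J. {n. ?e (n + fst p) x < snd p})"
        using J(2) by (intro density_one_INT) auto
      \<comment> \<open>Where all these errors are below their thresholds, the shifted sequence
        avoids every \<open>V p\<close> of the subcover, and only \<open>U\<close> is left to
        contain it.\<close>
      moreover have "(seq_shift ^^ n) x \<in> U" if n: "n \<in> (\<Inter>p\<in>J. {n. ?e (n + fst p) x < snd p})" for n
      proof -
        have "(seq_shift ^^ n) x \<notin> V p" if "p \<in> J" for p
          using n that by (cases p) (auto simp: V_def seq_shift_funpow dest!: bspec)
        then have "(seq_shift ^^ n) x \<notin> W" if "W \<in> \<F> - {U}" for W
          using that J(3) by auto
        then show ?thesis
          using \<F>(3) shift_in[of n] by blast
      qed
      ultimately show "density_one {n. (seq_shift ^^ n) x \<in> U}"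
        by (elim density_one_mono) auto
    qed
  qed
qed (simp add: vague_pseudo_orbit_def asymptotic_average_pseudo_orbit_def)

theorem theorem1:
  fixes X :: "'a topology" and T :: "'a \<Rightarrow> 'a" and \<rho> :: "'a \<Rightarrow> 'a \<Rightarrow> real"
  assumes "tds X T"
    and "compatible_metric X \<rho>"
    and "\<And>x y. x \<in> topspace X \<Longrightarrow> y \<in> topspace X \<Longrightarrow> \<rho> x y \<le> 1"
  shows "vague_specification X \<rho> T \<longleftrightarrow> asymptotic_average_shadowing X \<rho> T"
proof -
  interpret M: Metric_space "topspace X" \<rho>
    using assms(2) by (simp add: compatible_metric_def)
  have T_in: "T u \<in> topspace X" if "u \<in> topspace X" for u
    using assms(1) that by (auto simp: tds_def continuous_map_def)
  have orbit_in: "(T ^^ n) z \<in> topspace X" if "z \<in> topspace X" for n z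
    using that by (induction n) (auto simp: T_in)
  \<comment> \<open>For a fixed \<open>z\<close> the two tracing conditions agree, since the
    distances along the orbit and the pseudo-orbit lie in \<open>[0, 1]\<close>.\<close>
  have "besicovitch_dist \<rho> (orbit_seq T z) x = 0 \<longleftrightarrow>
      (\<forall>\<epsilon>>0. density_one {n. \<rho> ((T ^^ n) z) (x n) < \<epsilon>})"
    if "asymptotic_average_pseudo_orbit X \<rho> T x" "z \<in> topspace X" for x z
    using that unfolding besicovitch_dist_def orbit_seq_def
    by (intro limsup_average_eq_0_iff_density_one)
      (auto simp: asymptotic_average_pseudo_orbit_def topspace_seq_space orbit_in assms(3))
  moreover have "vague_pseudo_orbit X T x \<longleftrightarrow> asymptotic_average_pseudo_orbit X \<rho> T x" for x
    using assms by (rule vague_pseudo_orbit_iff)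
  \<comment> \<open>The rule \<open>bex_cong\<close> supplies \<open>z \<in> topspace X\<close>,
    which the equivalence of the tracing conditions requires.\<close>
  ultimately show ?thesis
    unfolding vague_specification_def asymptotic_average_shadowing_def by (simp cong: bex_cong)
qed

end
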